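(* Let $\mathbf K_{\rm ext}=\mathbf Z^3\setminus\mathbf K_{\rm int}$, where $\mathbf K_{\rm int}$ is a compact convex set of $\mathbf Z^3$. Let $\lambda\in\mathbf R$, $\lambda\neq0$. Then the unique continuation property (UCP) holds for the operator $\hat H^{D_p}-\lambda$ in $\mathbf K_{\rm ext}$; that is, every $\hat u:\mathbf Z^3\to\mathbf C^6$ with compact (finite) support satisfying $((\hat H^{D_p}-\lambda)\hat u)(n)=0$ for all $n\in\mathbf K_{\rm ext}$ vanishes on $\mathbf K_{\rm ext}$.
   Context: A compact convex set of $\mathbf Z^3$ is a set of the form $\Omega\cap\mathbf Z^3$ with $\Omega\subset\mathbf R^3$ bounded and convex. Operators: for sequences on $\mathbf Z^3$ let $(\hat y_j\hat u)(n)=\frac1{2i}(\hat u(n+e_j)-\hat u(n-e_j))$ (this is multiplication by $y_j=\sin x_j$ under the Fourier convention $u(x)=(2\pi)^{-3/2}\sum_n e^{-in\cdot x}\hat u(n)$). The isotropic discrete Maxwell operator $\hat H_0$ acts on sequences $\hat u:\mathbf Z^3\to\mathbf C^6$ as the block matrix $\begin{pmatrix}0&\tilde M\\-\tilde M&0\end{pmatrix}$, $\tilde M=\begin{pmatrix}0&-\hat y_3&\hat y_2\\ \hat y_3&0&-\hat y_1\\-\hat y_2&\hat y_1&0\end{pmatrix}$. Let $\epsilon_j,\mu_j\in(0,\infty)$ for $1\le j\le3$ and $\hat D=\mathrm{diag}(\epsilon_1,\epsilon_2,\epsilon_3,\mu_1,\mu_2,\mu_3)$. The perturbed operator is $\hat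 H^{D_p}=\hat D_p\hat H_0$, where $\hat D_p$ is multiplication by the real diagonal matrix $\hat D_p(n)=\mathrm{diag}(\tilde\epsilon_1(n),\tilde\epsilon_2(n),\tilde\epsilon_3(n),\tilde\mu_1(n),\tilde\mu_2(n),\tilde\mu_3(n))$ with $\tilde\epsilon_j(n)>0,\tilde\mu_j(n)>0$ for all $j$ and $n\in\mathbf Z^3$, and $\hat D_p(n)=\hat D$ for all but finitely many $n$. *)

theory Defs
  imports "HOL-Analysis.Analysis"
begin

text \<open>
  Points of the lattice are modelled by \<^typ>\<open>int ^ 3\<close>, vectors of field values by
  \<^typ>\<open>complex ^ 6\<close>. Coordinates are numbered from 1 (in \<^typ>\<open>3\<close> the numeral 3 denotes
  the same element as 0, so indices 1, 2, 3 are pairwise distinct; likewise for \<^typ>\<open>6\<close>).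
\<close>

definition lattice_point :: "int ^ 3 \<Rightarrow> real ^ 3" where
  "lattice_point n = (\<chi> j. real_of_int (n $ j))"

definition compact_convex_lattice_set :: "(int ^ 3) set \<Rightarrow> bool" where
  "compact_convex_lattice_set K \<longleftrightarrow>
     (\<exists>\<Omega> :: (real ^ 3) set. bounded \<Omega> \<and> convex \<Omega> \<and> K = {n. lattice_point n \<in> \<Omega>})"

text \<open>Multiplication by \<open>sin x\<^sub>j\<close>, seen on Fourier coefficients.\<close>

definition y_op :: "3 \<Rightarrow> (int ^ 3 \<Rightarrow> complex) \<Rightarrow> int ^ 3 \<Rightarrow> complex" where
  "y_op j f n = 1 / (2 * \<i>) * (f (n + axis j 1) - f (n - axis j 1))"

definition M_op :: "(int ^ 3 \<Rightarrow> complex ^ 3) \<Rightarrow> int ^ 3 \<Rightarrow> complex ^ 3" where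
  "M_op v n =
     (let f = (\<lambda>k m. v m $ k) in
      vector [- y_op 3 (f 2) n + y_op 2 (f 3) n,
              y_op 3 (f 1) n - y_op 1 (f 3) n,
              - y_op 2 (f 1) n + y_op 1 (f 2) n])"

definition upper :: "'a::zero ^ 6 \<Rightarrow> 'a ^ 3" where
  "upper w = vector [w $ 1, w $ 2, w $ 3]"

definition lower :: "'a::zero ^ 6 \<Rightarrow> 'a ^ 3" where
  "lower w = vector [w $ 4, w $ 5, w $ 6]"

definition stack :: "'a::zero ^ 3 \<Rightarrow> 'a ^ 3 \<Rightarrow> 'a ^ 6" where
  "stack a b = vector [a $ 1, a $ 2, a $ 3, b $ 1, b $ 2, b $ 3]"

lemma stack_components:
  "stack a b $ 1 = a $ 1" "stack a b $ 2 = a $ 2" "stack a b $ 3 = a $ 3"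
  "stack a b $ 4 = b $ 1" "stack a b $ 5 = b $ 2" "stack a b $ 6 = b $ 3"
  by (simp_all add: stack_def vector_def)

lemma upper_stack [simp]: "upper (stack a b) = a"
  and lower_stack [simp]: "lower (stack a b) = b"
  by (simp_all add: upper_def lower_def stack_components vec_eq_iff forall_3)

text \<open>The block matrix with zero diagonal blocks and off-diagonal blocks \<open>M\<close>, \<open>- M\<close>.\<close>

definition H0_op :: "(int ^ 3 \<Rightarrow> complex ^ 6) \<Rightarrow> int ^ 3 \<Rightarrow> complex ^ 6" where
  "H0_op u n = stack (M_op (\<lambda>m. lower (u m)) n) (- M_op (\<lambda>m. upper (u m)) n)"

definition diag_matrix :: "real ^ 'n \<Rightarrow> complex ^ 'n ^ 'n" where
  "diag_matrix d = (\<chi> i j. if i = j then complex_of_real (d $ i) else 0)"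

definition D_mat :: "real ^ 3 \<Rightarrow> real ^ 3 \<Rightarrow> complex ^ 6 ^ 6" where
  "D_mat \<epsilon> \<mu> = diag_matrix (stack \<epsilon> \<mu>)"

definition HDp_op ::
  "(int ^ 3 \<Rightarrow> real ^ 3) \<Rightarrow> (int ^ 3 \<Rightarrow> real ^ 3) \<Rightarrow>
   (int ^ 3 \<Rightarrow> complex ^ 6) \<Rightarrow> int ^ 3 \<Rightarrow> complex ^ 6" where
  "HDp_op \<epsilon>p \<mu>p u n = D_mat (\<epsilon>p n) (\<mu>p n) *v H0_op u n"

definition unique_continuation_property ::
  "((int ^ 3 \<Rightarrow> complex ^ 6) \<Rightarrow> int ^ 3 \<Rightarrow> complex ^ 6) \<Rightarrow> (int ^ 3) set \<Rightarrow> bool" where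
  "unique_continuation_property A K \<longleftrightarrow>
     (\<forall>u. finite {n. u n \<noteq> 0} \<longrightarrow> (\<forall>n\<in>K. A u n = 0) \<longrightarrow> (\<forall>n\<in>K. u n = 0))"

end

theory Submission
  imports Defs
begin

text \<open>
  Suppose \<open>u n\<^sub>0 \<noteq> 0\<close> for some \<open>n\<^sub>0\<close> outside \<open>K_int\<close>. A linear functional \<open>\<nu>\<close> separates
  \<open>n\<^sub>0\<close> strictly from the finite set \<open>K_int\<close>, and after a small perturbation one coefficient
  \<open>\<nu>\<^sub>k\<close> strictly dominates the others in absolute value. Let \<open>m\<close> maximise \<open>\<nu>\<close> on the support
  of \<open>u\<close> and let \<open>n = m \<plusminus> e\<^sub>k\<close>, with the sign of \<open>\<nu>\<^sub>k\<close>. Then \<open>\<nu>\<close> is larger than \<open>\<nu> m\<close> at \<open>n\<close> and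
  at all its neighbours except \<open>m\<close>, so \<open>u\<close> vanishes there. The equation at \<open>n\<close> says that the
  discrete curls of the two halves of \<open>u\<close> vanish at \<open>n\<close>, which kills their components at \<open>m\<close>
  transverse to \<open>e\<^sub>k\<close>. As curls are divergence free, so is the field \<open>\<lambda> E / \<epsilon>\<close> (and likewise
  \<open>\<lambda> H / \<mu>\<close>) at \<open>n\<close>, and this kills the component along \<open>e\<^sub>k\<close>. Hence \<open>u m = 0\<close>, a contradiction.
\<close>

section \<open>Difference operators and discrete curls near an extreme point\<close>

definition neighbourhood :: "int ^ 3 \<Rightarrow> (int ^ 3) set" where
  "neighbourhood n = insert n (range (\<lambda>j. n + axis j 1) \<union> range (\<lambda>j. n - axis j 1))"

lemma neighbourhood_simps [simp]:
  "n \<in> neighbourhood n" "n + axis j 1 \<in> neighbourhood n" "n - axis j 1 \<in> neighbourhood n"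
  by (auto simp: neighbourhood_def)

lemma y_op_eq_0_iff: "y_op j f n = 0 \<longleftrightarrow> f (n + axis j 1) = f (n - axis j 1)"
  by (simp add: y_op_def)

lemma M_op_components:
  "M_op v n $ 1 = - y_op 3 (\<lambda>m. v m $ 2) n + y_op 2 (\<lambda>m. v m $ 3) n"
  "M_op v n $ 2 = y_op 3 (\<lambda>m. v m $ 1) n - y_op 1 (\<lambda>m. v m $ 3) n"
  "M_op v n $ 3 = - y_op 2 (\<lambda>m. v m $ 1) n + y_op 1 (\<lambda>m. v m $ 2) n"
  by (simp_all add: M_op_def Let_def vector_def)

text \<open>The difference operators commute, so the mixed second differences cancel in
  pairs.\<close>

lemma div_M_op: "(\<Sum>j\<in>UNIV. y_op j (\<lambda>p. M_op v p $ j) n) = 0"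
  unfolding sum_3 M_op_components by (simp add: y_op_def algebra_simps)

lemma axis_uminus: "axis k (- t) = - axis k t" for t :: "'a::group_add"
  by (simp add: vec_eq_iff axis_def)

text \<open>\<open>m\<close> is exactly one of the two points that \<open>y_op k\<close> samples at
  \<open>n\<close>, and none of the points sampled in the other directions.\<close>

lemma vanishing_y_op:
  assumes "\<And>p. p \<in> neighbourhood n \<Longrightarrow> p \<noteq> m \<Longrightarrow> f p = 0"
    and "m = n - axis k s" and "s \<in> {1, -1}"
  shows "j \<noteq> k \<Longrightarrow> y_op j f n = 0"
    and "y_op k f n = 0 \<longleftrightarrow> f m = 0"
proof -
  have ne: "n + axis j 1 \<noteq> m" "n - axis j 1 \<noteq> m" if "j \<noteq> k" for j
    using that assms(2,3) by (auto simp: vec_eq_iff axis_def)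
  then show "j \<noteq> k \<Longrightarrow> y_op j f n = 0"
    by (simp add: y_op_eq_0_iff assms(1))
  have "n + axis k 1 \<noteq> n - axis k 1"
    by (auto simp: vec_eq_iff axis_def)
  moreover have "m = n + axis k 1 \<or> m = n - axis k 1"
    using assms(2,3) by (auto simp: axis_uminus)
  ultimately show "y_op k f n = 0 \<longleftrightarrow> f m = 0"
    using assms(1)[of "n + axis k 1"] assms(1)[of "n - axis k 1"]
    by (auto simp: y_op_eq_0_iff)
qed

text \<open>Each curl component transverse to direction \<open>k\<close> contains a single
  difference in that direction, taken of the other transverse component of \<open>v\<close>; its
  remaining term vanishes at \<open>n\<close>.\<close>

lemma M_op_0_transverse:
  assumes "\<And>p. p \<in> neighbourhood n \<Longrightarrow> p \<noteq> m \<Longrightarrow> v p = 0"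
    and "m = n - axis k s" and "s \<in> {1, -1}"
    and "M_op v n = 0" and "j \<noteq> k"
  shows "v m $ j = 0"
proof -
  have z: "y_op i (\<lambda>m. v m $ l) n = 0" if "i \<noteq> k" for i l
    using vanishing_y_op(1)[OF _ assms(2,3) that, of "\<lambda>m. v m $ l"] assms(1) by simp
  have y: "y_op k (\<lambda>m. v m $ l) n = 0 \<longleftrightarrow> v m $ l = 0" for l
    using vanishing_y_op(2)[OF _ assms(2,3), of "\<lambda>m. v m $ l"] assms(1) by simp
  have eqs: "M_op v n $ 1 = 0" "M_op v n $ 2 = 0" "M_op v n $ 3 = 0"
    using assms(4) by simp_all
  have "k = 1 \<or> k = 2 \<or> k = 3" "j = 1 \<or> j = 2 \<or> j = 3"
    using exhaust_3 by auto
  then have "y_op k (\<lambda>m. v m $ j) n = 0"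
    using eqs \<open>j \<noteq> k\<close> z unfolding M_op_components by auto
  then show ?thesis
    using y by simp
qed

text \<open>The equation enters only through the zero patterns \<open>UV\<close> and
  \<open>VU\<close>, so weights and eigenvalue drop out and the roles of \<open>U\<close> and
  \<open>V\<close> can be exchanged. The divergence at \<open>n\<close> samples the curl at the
  neighbours of \<open>n\<close>, \<open>m\<close> included, hence the range of
  \<open>p\<close>.\<close>

lemma maxwell_vanishes_at_extreme_point:
  assumes "\<And>p. p \<in> neighbourhood n \<Longrightarrow> p \<noteq> m \<Longrightarrow> U p = 0"
    and "\<And>p. p \<in> neighbourhood n \<Longrightarrow> p \<noteq> m \<Longrightarrow> V p = 0"
    and m: "m = n - axis k s" "s \<in> {1, -1}"
    and UV: "\<And>p j. p \<in> neighbourhood n \<Longrightarrow> M_op V p $ j = 0 \<longleftrightarrow> U p $ j = 0"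
    and VU: "\<And>p j. p \<in> neighbourhood n \<Longrightarrow> M_op U p $ j = 0 \<longleftrightarrow> V p $ j = 0"
  shows "U m = 0"
proof -
  have "n \<noteq> m"
    using m by (auto simp: vec_eq_iff axis_def)
  then have "M_op U n = 0"
    using VU[of n] assms(2)[of n] by (simp add: vec_eq_iff)
  from M_op_0_transverse[OF assms(1) m this]
  have transverse: "U m $ j = 0" if "j \<noteq> k" for j
    using that by simp
  let ?g = "\<lambda>j p. M_op V p $ j"
  \<comment> \<open>The curl of \<open>V\<close> inherits from \<open>U\<close> the vanishing off
    \<open>m\<close>, so its divergence at \<open>n\<close> reduces to the difference in direction
    \<open>k\<close>.\<close>
  have "?g j p = 0" if "p \<in> neighbourhood n" "p \<noteq> m" for j p
    using UV that assms(1) by simp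
  note y = vanishing_y_op[OF this m]
  have "y_op k (?g k) n = (\<Sum>j\<in>UNIV. y_op j (?g j) n)"
    using y(1) by (subst sum.remove[of _ k]) auto
  then have "M_op V m $ k = 0"
    using y(2) by (simp add: div_M_op)
  moreover have "m \<in> neighbourhood n"
    using m by (auto simp: axis_uminus)
  ultimately have "U m $ k = 0"
    using UV by blast
  with transverse show ?thesis
    by (metis vec_eq_iff zero_index)
qed

section \<open>From six components to two coupled fields\<close>

lemma eq_0_iff_upper_lower: "w = 0 \<longleftrightarrow> upper w = 0 \<and> lower w = 0"
  for w :: "'a::zero ^ 6"
proof
  assume "upper w = 0 \<and> lower w = 0"
  then have "upper w $ j = 0" "lower w $ j = 0" for j
    by simp_all
  from this[of 1] this[of 2] this[of 3]
  have w: "w $ 1 = 0" "w $ 2 = 0" "w $ 3 = 0" "w $ 4 = 0" "w $ 5 = 0" "w $ 6 = 0"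
    by (simp_all add: upper_def lower_def)
  \<comment> \<open>Induction on the index type runs over the representatives 0 to 5, whereas
    components are numbered 1 to 6.\<close>
  have "(6 :: 6) = 0"
    by simp
  then have "w $ 0 = 0"
    using w(6) by metis
  have "w $ i = 0" for i
  proof (induct i)
    case (of_int z)
    then have "z = 0 \<or> z = 1 \<or> z = 2 \<or> z = 3 \<or> z = 4 \<or> z = 5" by fastforce
    then show ?case using w \<open>w $ 0 = 0\<close> by auto
  qed
  then show "w = 0"
    by (simp add: vec_eq_iff)
qed (simp add: upper_def lower_def vec_eq_iff forall_3)

lemma diag_matrix_mult_component: "(diag_matrix d *v w) $ i = complex_of_real (d $ i) * w $ i"
  by (simp add: diag_matrix_def matrix_vector_mult_def if_distrib [of "\<lambda>x. x * _"] cong: if_cong)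

text \<open>Row by row, a nonzero weight times a curl component, up to sign, equals
  \<open>lam\<close> times a field component, and \<open>lam\<close> is nonzero too.\<close>

lemma HDp_op_eigen_iff:
  fixes lam :: real
  assumes "HDp_op \<epsilon>p \<mu>p u n - complex_of_real lam *s u n = 0"
    and "\<And>j. \<epsilon>p n $ j > 0" and "\<And>j. \<mu>p n $ j > 0" and "lam \<noteq> 0"
  shows "M_op (\<lambda>m. lower (u m)) n $ j = 0 \<longleftrightarrow> upper (u n) $ j = 0"
    and "M_op (\<lambda>m. upper (u m)) n $ j = 0 \<longleftrightarrow> lower (u n) $ j = 0"
proof -
  have c: "complex_of_real (stack (\<epsilon>p n) (\<mu>p n) $ i) * H0_op u n $ i = lam * u n $ i" for i
    using arg_cong[OF assms(1), of "\<lambda>w. w $ i"]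
    by (simp add: HDp_op_def D_mat_def diag_matrix_mult_component)
  have pos: "\<epsilon>p n $ i \<noteq> 0" "\<mu>p n $ i \<noteq> 0" for i
    using assms(2)[of i] assms(3)[of i] by auto
  have "j = 1 \<or> j = 2 \<or> j = 3"
    using exhaust_3 by auto
  then show "M_op (\<lambda>m. lower (u m)) n $ j = 0 \<longleftrightarrow> upper (u n) $ j = 0"
    using c[of 1] c[of 2] c[of 3] pos[of j] \<open>lam \<noteq> 0\<close>
    by (auto simp: H0_op_def stack_components upper_def)
  from \<open>j = 1 \<or> j = 2 \<or> j = 3\<close>
  show "M_op (\<lambda>m. upper (u m)) n $ j = 0 \<longleftrightarrow> lower (u n) $ j = 0"
    using c[of 4] c[of 5] c[of 6] pos[of j] \<open>lam \<noteq> 0\<close>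
    by (auto simp: H0_op_def stack_components lower_def)
qed

section \<open>Finiteness and strict separation of lattice sets\<close>

lemma finite_compact_convex_lattice_set:
  assumes "compact_convex_lattice_set K"
  shows "finite K"
proof -
  obtain \<Omega> where \<Omega>: "bounded \<Omega>" "K = {n. lattice_point n \<in> \<Omega>}"
    using assms by (auto simp: compact_convex_lattice_set_def)
  then obtain B where B: "\<And>x. x \<in> \<Omega> \<Longrightarrow> norm x \<le> B"
    by (auto simp: bounded_iff)
  have "K \<subseteq> {n. \<forall>j. n $ j \<in> {- \<lceil>B\<rceil>..\<lceil>B\<rceil>}}"
  proof clarify
    fix n j
    assume "n \<in> K"
    then have "\<bar>real_of_int (n $ j)\<bar> \<le> B"
      using component_le_norm_cart[of "lattice_point n" j] B[of "lattice_point n"] \<Omega>(2)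
      by (simp add: lattice_point_def)
    then show "n $ j \<in> {- \<lceil>B\<rceil>..\<lceil>B\<rceil>}"
      by (simp add: abs_le_iff) linarith
  qed
  moreover have "finite {n :: int ^ 3. \<forall>j. n $ j \<in> {- \<lceil>B\<rceil>..\<lceil>B\<rceil>}}"
  proof (rule finite_imageD)
    show "finite (vec_nth ` {n :: int ^ 3. \<forall>j. n $ j \<in> {- \<lceil>B\<rceil>..\<lceil>B\<rceil>}})"
      by (rule finite_subset[OF _ finite_PiE[of UNIV "\<lambda>_. {- \<lceil>B\<rceil>..\<lceil>B\<rceil>}"]]) auto
  qed (auto simp: inj_on_def vec_nth_inject)
  ultimately show ?thesis
    by (rule finite_subset)
qed

lemma separating_functional_dominant:
  assumes "compact_convex_lattice_set K" and "z \<notin> K"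
  obtains a k where "\<And>x. x \<in> K \<Longrightarrow> a \<bullet> lattice_point x < a \<bullet> lattice_point z"
    and "\<And>j. j \<noteq> k \<Longrightarrow> \<bar>a $ j\<bar> < \<bar>a $ k\<bar>"
proof -
  obtain \<Omega> where \<Omega>: "convex \<Omega>" "K = {n. lattice_point n \<in> \<Omega>}"
    using assms by (auto simp: compact_convex_lattice_set_def)
  have fin: "finite K"
    using assms(1) by (rule finite_compact_convex_lattice_set)
  \<comment> \<open>\<Omega> may fail to be closed; the hull of the finite set \<open>K\<close> is
    compact and still misses \<open>z\<close>, so strict separation applies.\<close>
  let ?H = "convex hull (lattice_point ` K)"
  have "?H \<subseteq> \<Omega>"
    using \<Omega> by (intro hull_minimal) auto
  then have "lattice_point z \<notin> ?H"
    using assms(2) \<Omega>(2) by auto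
  moreover have "closed ?H"
    using fin by (simp add: finite_imp_compact_convex_hull compact_imp_closed)
  ultimately obtain b0 c where "b0 \<bullet> lattice_point z < c" "\<And>x. x \<in> ?H \<Longrightarrow> c < b0 \<bullet> x"
    using separating_hyperplane_closed_point[OF convex_convex_hull] by metis
  then have "(- b0) \<bullet> lattice_point x < (- b0) \<bullet> lattice_point z" if "x \<in> K" for x
    using that hull_subset[of "lattice_point ` K" convex] by fastforce
  then obtain b :: "real ^ 3"
    where b: "\<And>x. x \<in> K \<Longrightarrow> b \<bullet> lattice_point x < b \<bullet> lattice_point z"
    by blast
  have "Max (range (\<lambda>j. \<bar>b $ j\<bar>)) \<in> range (\<lambda>j. \<bar>b $ j\<bar>)"
    by (rule Max_in) auto
  then obtain k where "Max (range (\<lambda>j. \<bar>b $ j\<bar>)) = \<bar>b $ k\<bar>"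
    by (rule rangeE)
  then have k: "\<bar>b $ j\<bar> \<le> \<bar>b $ k\<bar>" for j
    using Max_ge[of "range (\<lambda>j. \<bar>b $ j\<bar>)" "\<bar>b $ j\<bar>"] by simp
  \<comment> \<open>This sign gives \<open>\<bar>b $ k + \<delta> * s\<bar> = \<bar>b $ k\<bar> +
    \<delta>\<close> for \<delta> > 0, which breaks ties for the largest coefficient, even when
    \<open>b = 0\<close>.\<close>
  define s :: real where "s = (if b $ k \<ge> 0 then 1 else -1)"
  define a where "a \<delta> = b + axis k (\<delta> * s)" for \<delta>
  have inner: "a \<delta> \<bullet> x = b \<bullet> x + \<delta> * s * x $ k" for \<delta> x
    by (simp add: a_def inner_add_left inner_axis')
  \<comment> \<open>Each strict inequality survives a small perturbation by continuity; finiteness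
    of \<open>K\<close> then provides a common \<delta>.\<close>
  have "\<forall>\<^sub>F \<delta> in at_right 0. a \<delta> \<bullet> lattice_point x < a \<delta> \<bullet> lattice_point z" if "x \<in> K" for x
  proof -
    have "((\<lambda>\<delta>. a \<delta> \<bullet> lattice_point z - a \<delta> \<bullet> lattice_point x) \<longlongrightarrow>
        (b \<bullet> lattice_point z + 0 * s * lattice_point z $ k)
        - (b \<bullet> lattice_point x + 0 * s * lattice_point x $ k)) (at_right 0)"
      unfolding inner by (intro tendsto_intros)
    then have "\<forall>\<^sub>F \<delta> in at_right 0. 0 < a \<delta> \<bullet> lattice_point z - a \<delta> \<bullet> lattice_point x"
      by (rule order_tendstoD(1)) (use b[OF that] in simp)
    then show ?thesis
      by eventually_elim simp
  qed
  then have "\<forall>\<^sub>F \<delta> in at_right 0. \<forall>x\<in>K. a \<delta> \<bullet> lattice_point x < a \<delta> \<bullet> lattice_point z"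
    using fin by (simp add: eventually_ball_finite)
  then have "\<forall>\<^sub>F \<delta> in at_right 0. \<delta> > 0 \<and>
      (\<forall>x\<in>K. a \<delta> \<bullet> lattice_point x < a \<delta> \<bullet> lattice_point z)"
    using eventually_at_right_less[of 0] by eventually_elim simp
  then obtain \<delta> :: real where \<delta>: "\<delta> > 0"
    "\<And>x. x \<in> K \<Longrightarrow> a \<delta> \<bullet> lattice_point x < a \<delta> \<bullet> lattice_point z"
    using eventually_happens'[OF trivial_limit_at_right_real] by blast
  have "\<bar>a \<delta> $ j\<bar> < \<bar>a \<delta> $ k\<bar>" if "j \<noteq> k" for j
    using k[of j] that \<open>\<delta> > 0\<close> by (auto simp: a_def s_def axis_def)
  with \<delta>(2) show thesis
    by (rule that)
qed

section \<open>The extremal argument on the support\<close>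

lemma lattice_point_add_axis: "lattice_point (n + axis j t) = lattice_point n + axis j (real_of_int t)"
  and lattice_point_diff_axis: "lattice_point (n - axis j t) = lattice_point n - axis j (real_of_int t)"
  by (auto simp: lattice_point_def vec_eq_iff axis_def)

theorem theorem1p4:
  fixes \<epsilon> \<mu> :: "real ^ 3"
    and \<epsilon>p \<mu>p :: "int ^ 3 \<Rightarrow> real ^ 3"
    and K_int K_ext :: "(int ^ 3) set"
    and lam :: real
  assumes "\<And>j. \<epsilon> $ j > 0" and "\<And>j. \<mu> $ j > 0"
    and "\<And>n j. \<epsilon>p n $ j > 0" and "\<And>n j. \<mu>p n $ j > 0"
    and "finite {n. D_mat (\<epsilon>p n) (\<mu>p n) \<noteq> D_mat \<epsilon> \<mu>}"
    and "compact_convex_lattice_set K_int"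
    and "K_ext = UNIV - K_int"
    and "lam \<noteq> 0"
  shows "unique_continuation_property
           (\<lambda>u n. HDp_op \<epsilon>p \<mu>p u n - complex_of_real lam *s u n) K_ext"
  unfolding unique_continuation_property_def
proof (intro allI impI ballI, rule ccontr)
  fix u n\<^sub>0
  assume fin: "finite {n. u n \<noteq> 0}"
    and eq: "\<forall>n\<in>K_ext. HDp_op \<epsilon>p \<mu>p u n - complex_of_real lam *s u n = 0"
    and n\<^sub>0: "n\<^sub>0 \<in> K_ext" "u n\<^sub>0 \<noteq> 0"
  have "n\<^sub>0 \<notin> K_int"
    using n\<^sub>0 assms(7) by simp
  from separating_functional_dominant[OF assms(6) this] obtain a k
    where sep: "\<And>x. x \<in> K_int \<Longrightarrow> a \<bullet> lattice_point x < a \<bullet> lattice_point n\<^sub>0"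
      and dom: "\<And>j. j \<noteq> k \<Longrightarrow> \<bar>a $ j\<bar> < \<bar>a $ k\<bar>"
    by blast
  define f where "f x = a \<bullet> lattice_point x" for x
  obtain m where m: "u m \<noteq> 0" "\<And>x. u x \<noteq> 0 \<Longrightarrow> f x \<le> f m"
  proof -
    have "Max (f ` {n. u n \<noteq> 0}) \<in> f ` {n. u n \<noteq> 0}"
      using fin n\<^sub>0(2) by (intro Max_in) auto
    then obtain m where "u m \<noteq> 0" "f m = Max (f ` {n. u n \<noteq> 0})"
      by auto
    with fin that show thesis
      by auto
  qed
  define s :: int where "s = (if a $ k \<ge> 0 then 1 else -1)"
  define n where "n = m + axis k s"
  have s: "s \<in> {1, -1}" "a $ k * real_of_int s = \<bar>a $ k\<bar>"
    by (auto simp: s_def)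
  have mn: "m = n - axis k s"
    by (simp add: n_def)
  \<comment> \<open>A second index exists, so strict dominance forces \<open>a $ k\<close> to be
    nonzero.\<close>
  obtain j where "j \<noteq> k"
    by (metis zero_neq_one)
  then have pos: "\<bar>a $ k\<bar> > 0"
    using dom[of j] by linarith
  have fn: "f n = f m + \<bar>a $ k\<bar>"
    using s(2) by (simp add: f_def n_def lattice_point_add_axis inner_add_right inner_axis)
  \<comment> \<open>Passing from \<open>m\<close> to \<open>n\<close> gains
    \<open>\<bar>a $ k\<bar>\<close>. A further step along another axis loses strictly less, and a
    step along axis \<open>k\<close> either gains again or returns to \<open>m\<close>.\<close>
  have f_ge: "f p > f m \<or> p = m" if "p \<in> neighbourhood n" for p
  proof -
    have step: "f (n + axis j 1) = f n + a $ j" "f (n - axis j 1) = f n - a $ j" for j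
      by (simp_all add: f_def lattice_point_add_axis lattice_point_diff_axis
          inner_add_right inner_diff_right inner_axis)
    consider "p = n" | j where "p = n + axis j 1" | j where "p = n - axis j 1"
      using \<open>p \<in> neighbourhood n\<close> by (auto simp: neighbourhood_def)
    then show ?thesis
    proof cases
      case 1
      then show ?thesis using fn pos by simp
    next
      case (2 j)
      show ?thesis
      proof (cases "j = k")
        case True
        then show ?thesis
          using 2 step(1)[of k] fn pos mn by (cases "a $ k \<ge> 0") (auto simp: s_def axis_uminus)
      next
        case False
        then show ?thesis using 2 step(1)[of j] fn dom[of j] by auto
      qed
    next
      case (3 j)
      show ?thesis
      proof (cases "j = k")
        case True
        then show ?thesis
          using 3 step(2)[of k] fn pos mn by (cases "a $ k \<ge> 0") (auto simp: s_def axis_uminus)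
      next
        case False
        then show ?thesis using 3 step(2)[of j] fn dom[of j] by auto
      qed
    qed
  qed
  have van: "u p = 0" if "p \<in> neighbourhood n" "p \<noteq> m" for p
    using f_ge[OF that(1)] that(2) m(2)[of p] by fastforce
  \<comment> \<open>On the neighbourhood, \<open>f p\<close> is at least \<open>f m\<close>, hence
    at least \<open>f n\<^sub>0\<close>, which exceeds every value of \<open>f\<close> on
    \<open>K_int\<close>.\<close>
  have "p \<in> K_ext" if "p \<in> neighbourhood n" for p
    using f_ge[OF that] m(2)[OF n\<^sub>0(2)] sep[of p] assms(7) by (fastforce simp: f_def)
  then have "HDp_op \<epsilon>p \<mu>p u p - complex_of_real lam *s u p = 0" if "p \<in> neighbourhood n" for p
    using that eq by blast
  note iff = HDp_op_eigen_iff[OF this assms(3,4,8)]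
  have "upper (u p) = 0" "lower (u p) = 0" if "p \<in> neighbourhood n" "p \<noteq> m" for p
    using van[OF that] eq_0_iff_upper_lower by blast+
  then have "upper (u m) = 0" "lower (u m) = 0"
    using maxwell_vanishes_at_extreme_point[of n m "\<lambda>p. upper (u p)" "\<lambda>p. lower (u p)", OF _ _ mn s(1)]
      maxwell_vanishes_at_extreme_point[of n m "\<lambda>p. lower (u p)" "\<lambda>p. upper (u p)", OF _ _ mn s(1)]
      iff by blast+
  with m(1) show False
    by (simp add: eq_0_iff_upper_lower)
qed

end
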